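(* Let $\sigma_0<\sigma_1$ and $T>0$ be real, and let $\eta\in(0,1)$ be the unique solution of $1+\eta+\log(\eta)=0$. Assume $c\in[\sigma_0,\sigma_1]$ satisfies $\sigma_1-c\le\eta(c-\sigma_0)$, and let $r=c-\sigma_0$. Suppose $f$ is analytic on the (closed) disc of radius $r$ centered at $c+iT$ and on its complex conjugate, that $\overline{f(s)}=f(\overline s)$, and that $f$ has no zeros on the line segment connecting $\sigma_0+iT$ to $\sigma_1+iT$. Suppose $F_{c,r}(\theta)$ is an even, integrable, real valued function of $\theta\in[-\pi,\pi]$ such that $$\max\left(\log|f(c+re^{i\theta}+iT)|,\ \log|f(c+re^{i\theta}-iT)|\right)\le F_{c,r}(\theta).$$ Then $$\frac1{2\pi}\left|\int_{\sigma_1}^{\sigma_0}\arg f(\sigma+iT)\,d\sigma-(\sigma_0-\sigma_1)\arg f(\sigma_1+iT)\right|\le\frac{c-\sigma_0}{2}\left(-\log|f(c+iT)|+\frac1\pi\int_0^\pi F_{c,r}(\theta)\,d\theta\right),$$ where $\arg f$ denotes a continuous argument of $f$ along the line segment connecting $\sigma_0+iT$ to $\sigma_1+iT$.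
   Context: A function is analytic on a closed disc if it is analytic on an open neighbourhood of it. *)

theory Defs
  imports "HOL-Complex_Analysis.Complex_Analysis"
begin

text \<open>The logarithm of the modulus with the convention that it is \<open>-\<infinity>\<close> at zero
  (HOL's real \<^const>\<open>ln\<close> has \<open>ln 0 = 0\<close>).\<close>

definition log_abs :: "complex \<Rightarrow> ereal" where
  "log_abs z = (if z = 0 then - \<infinity> else ereal (ln (cmod z)))"

definition continuous_argument_on :: "(complex \<Rightarrow> complex) \<Rightarrow> complex set \<Rightarrow> (complex \<Rightarrow> real) \<Rightarrow> bool" where
  "continuous_argument_on f S a \<longleftrightarrow>
     continuous_on S a \<and> (\<forall>z\<in>S. f z = complex_of_real (cmod (f z)) * cis (a z))"

end

theory Submission
  imports Defs
begin

text \<open>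
  This is Backlund's trick. For \<open>m \<ge> 1\<close> let \<open>g z = (f (z + \<i>T) ^ m + f (z - \<i>T) ^ m) / 2\<close>, which equals
  \<open>Re (f (x + \<i>T) ^ m)\<close> at real \<open>x\<close>. If \<open>g\<close> has \<open>n\<close> zeros in \<open>[\<sigma>, \<sigma>\<^sub>1]\<close>, then \<open>m arg f\<close> varies by at most
  \<open>\<pi> (n + 1)\<close> between \<open>\<sigma>\<close> and \<open>\<sigma>\<^sub>1\<close>. Integrating over \<open>\<sigma>\<close>, each zero \<open>x\<close> contributes \<open>x - \<sigma>\<^sub>0\<close>, and the
  choice of \<open>\<eta>\<close> is exactly what makes \<open>x - \<sigma>\<^sub>0 \<le> r log (r / \<bar>x - c\<bar>)\<close>. Jensen's inequality then bounds the
  sum of these terms by the mean of \<open>m F\<close> minus \<open>log \<bar>g c\<bar>\<close>. Letting \<open>m\<close> tend to infinity through values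
  with \<open>\<bar>cos (m arg f (c + \<i>T))\<bar> \<ge> 1 / 2\<close> removes the error terms.
\<close>

section \<open>Riemann sums of continuous periodic functions\<close>

lemma integral_periodic_shift:
  fixes g :: "real \<Rightarrow> real"
  assumes "continuous_on UNIV g" and "\<And>x. g (x + p) = g x" and x: "x \<in> {a..a+p}"
  shows "integral {x..x+p} g = integral {a..a+p} g"
proof -
  have int: "g integrable_on {u..v}" for u v
    using assms(1) by (intro integrable_continuous_interval) (rule continuous_on_subset, auto)
  have "integral {x..x+p} g = integral {x..a+p} g + integral {a+p..x+p} g"
    using x int by (intro Henstock_Kurzweil_Integration.integral_combine[symmetric]) auto
  also have "integral {a+p..x+p} g = integral {a..x} (g \<circ> ((+) p))"
    by (rule integral_shift_Icc_real[symmetric])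
  also have "g \<circ> ((+) p) = g"
    using assms(2) by (auto simp: fun_eq_iff add.commute)
  also have "integral {x..a+p} g + integral {a..x} g = integral {a..a+p} g"
    using x int Henstock_Kurzweil_Integration.integral_combine[of a x "a+p" g] by simp
  finally show ?thesis .
qed

text \<open>The point is that one \<open>n\<close> serves all starting points \<open>x\<close>,
  since the maximum principle needs a bound at every point of a circle. Uniform continuity controls
  the error, and the integral over a full period does not depend on \<open>x\<close>.\<close>

lemma periodic_riemann_sum_le:
  fixes g :: "real \<Rightarrow> real"
  assumes cont: "continuous_on UNIV g" and per: "\<And>x. g (x + p) = g x" and "p > 0" "e > 0"
  obtains n :: nat where "n > 0"
    "\<And>x. x \<in> {a..a+p} \<Longrightarrow> p / n * (\<Sum>k<n. g (x + real k * (p / n))) \<le> integral {a..a+p} g + e"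
proof -
  have int: "g integrable_on {u..v}" for u v
    using cont by (intro integrable_continuous_interval) (rule continuous_on_subset, auto)
  \<comment> \<open>Two periods are needed: \<open>x\<close> ranges over the first one and the
    samples run up to \<open>x + p\<close>.\<close>
  have "uniformly_continuous_on {a..a+2*p} g"
    using cont by (intro compact_uniformly_continuous) (auto intro: continuous_on_subset)
  moreover have "e / p > 0" using assms by simp
  ultimately obtain d where d: "d > 0"
    "\<And>x y. x \<in> {a..a+2*p} \<Longrightarrow> y \<in> {a..a+2*p} \<Longrightarrow> dist y x < d \<Longrightarrow> dist (g y) (g x) < e / p"
    unfolding uniformly_continuous_on_def by metis
  obtain n :: nat where n: "real n > p / d"
    using reals_Archimedean2 by blast
  have n0: "n > 0" using n \<open>p > 0\<close> d(1) by (cases n) (auto simp: field_simps)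
  define h where "h = p / n"
  have h: "h > 0" "h < d" "n * h = p"
    using n n0 \<open>p > 0\<close> d(1) by (auto simp: h_def field_simps)
  show ?thesis
  proof
    show "n > 0" by fact
    fix x assume x: "x \<in> {a..a+p}"
    \<comment> \<open>Each cell of length \<open>h\<close> costs at most \<open>h * (e / p)\<close>,
      so all \<open>n\<close> cells together cost \<open>e\<close>, because
      \<open>n * h = p\<close>.\<close>
    have "h * (\<Sum>k<j. g (x + real k * h)) \<le> integral {x..x + j * h} g + j * (h * (e / p))" if "j \<le> n" for j
      using that
    proof (induction j)
      case (Suc j)
      have jh: "(j + 1) * h \<le> p" "0 \<le> j * h"
        using Suc.prems h mult_right_mono[of "real (j+1)" n h] by auto
      have "h * (g (x + j * h) - e / p) = integral {x + j * h..x + (j+1) * h} (\<lambda>_. g (x + j * h) - e / p)"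
        using h by (simp add: algebra_simps)
      also have "\<dots> \<le> integral {x + j * h..x + (j+1) * h} g"
      proof (rule integral_le[OF _ int])
        fix y assume y: "y \<in> {x + j * h..x + (j+1) * h}"
        then have "dist (x + j * h) y < d" using h by (auto simp: dist_real_def algebra_simps)
        moreover have "x + j * h \<in> {a..a+2*p}" "y \<in> {a..a+2*p}"
          using x y jh h(1) \<open>p > 0\<close> unfolding atLeastAtMost_iff by (simp_all only: of_nat_add of_nat_1 distrib_right mult_1) linarith+
        ultimately show "g (x + j * h) - e / p \<le> g y"
          using d(2)[of y "x + j * h"] by (auto simp: dist_real_def)
      qed auto
      finally have "h * (g (x + j * h) - e / p) \<le> integral {x + j * h..x + (j+1) * h} g" .
      moreover have "integral {x..x + (j+1) * h} g
          = integral {x..x + j * h} g + integral {x + j * h..x + (j+1) * h} g"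
        using jh h int by (intro Henstock_Kurzweil_Integration.integral_combine[symmetric])
          (auto simp: algebra_simps)
      ultimately show ?case
        using Suc by (simp add: algebra_simps add_divide_distrib)
    qed auto
    from this[of n] show "p / n * (\<Sum>k<n. g (x + real k * (p / n))) \<le> integral {a..a+p} g + e"
      using integral_periodic_shift[OF cont per x] \<open>p > 0\<close> h n0 by (simp add: h_def)
  qed
qed

section \<open>Jensen's inequality on a disc, with an integrable majorant on the circle\<close>

lemma ln_cmod_le_integral_continuous:
  fixes h :: "complex \<Rightarrow> complex"
  assumes "r > 0" and cont: "continuous_on (cball c r) h" and hol: "h holomorphic_on ball c r"
    and "h c \<noteq> 0" and contg: "continuous_on UNIV g" and per: "\<And>x. g (x + 2 * pi) = g x"
    and bound: "\<And>t. cmod (h (c + of_real r * cis t)) \<le> exp (g t)"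
  shows "2 * pi * ln (cmod (h c)) \<le> integral {-pi..pi} g"
proof (rule field_le_epsilon)
  fix e :: real assume "e > 0"
  then obtain n :: nat where n: "n > 0"
    "\<And>x. x \<in> {-pi..-pi + 2 * pi} \<Longrightarrow>
       2 * pi / n * (\<Sum>k<n. g (x + real k * (2 * pi / n))) \<le> integral {-pi..-pi + 2 * pi} g + e"
    using periodic_riemann_sum_le[OF contg per, of e "-pi"] by auto
  \<comment> \<open>The maximum principle for the product of \<open>n\<close> rotated copies of \<open>h\<close> turns the bound on the circle
    into a Riemann sum of \<open>g\<close>, so no zeros of \<open>h\<close> have to be removed.\<close>
  define B where "B = exp (n / (2 * pi) * (integral {-pi..pi} g + e))"
  define rot where "rot k z = c + z * cis (k * (2 * pi / n))" for k :: nat and z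
  define P where "P z = (\<Prod>k<n. h (rot k z))" for z
  have "cmod (P 0) \<le> B"
  proof (rule maximum_modulus_frontier[where S = "cball 0 r" and f = P and \<xi> = 0])
    have "rot k z \<in> ball c r" if "z \<in> ball 0 r" for k z
      using that by (simp add: rot_def dist_norm norm_mult)
    then have "(\<lambda>z. h (rot k z)) holomorphic_on ball 0 r" for k
      by (intro holomorphic_on_compose_gen[OF _ hol, unfolded o_def])
        (auto simp: rot_def intro!: holomorphic_intros)
    then show "P holomorphic_on interior (cball 0 r)"
      unfolding P_def by (auto intro!: holomorphic_intros)
    have "rot k z \<in> cball c r" if "z \<in> cball 0 r" for k z
      using that by (simp add: rot_def dist_norm norm_mult)
    then have "continuous_on (cball 0 r) (\<lambda>z. h (rot k z))" for k
      by (intro continuous_on_compose2[OF cont]) (auto simp: rot_def intro!: continuous_intros)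
    then show "continuous_on (closure (cball 0 r)) P"
      unfolding P_def by (auto intro!: continuous_intros)
    show "0 \<in> cball 0 r" using \<open>r > 0\<close> by simp
    fix z assume "z \<in> frontier (cball (0::complex) r)"
    then have z: "z = of_real r * cis (Arg z)"
      using rcis_cmod_Arg[of z] by (simp add: rcis_def)
    have "cmod (P z) = (\<Prod>k<n. cmod (h (rot k z)))"
      by (simp add: P_def prod_norm)
    also have "\<dots> \<le> (\<Prod>k<n. exp (g (Arg z + real k * (2 * pi / n))))"
    proof (intro prod_mono conjI)
      fix k
      have "rot k z = c + of_real r * cis (Arg z + real k * (2 * pi / n))"
        unfolding rot_def by (subst z) (simp add: cis_mult mult.assoc)
      then show "cmod (h (rot k z)) \<le> exp (g (Arg z + real k * (2 * pi / n)))"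
        using bound by simp
    qed auto
    also have "\<dots> = exp (\<Sum>k<n. g (Arg z + real k * (2 * pi / n)))"
      by (simp add: exp_sum)
    also have "\<dots> \<le> B"
      using n(2)[of "Arg z"] Arg_bounded[of z] n(1) by (simp add: B_def field_simps)
    finally show "cmod (P z) \<le> B" .
  qed auto
  \<comment> \<open>All rotations fix the centre, so \<open>P 0 = h c ^ n\<close>.\<close>
  then have "cmod (h c) ^ n \<le> B"
    by (simp add: P_def rot_def norm_power)
  then have "ln (cmod (h c) ^ n) \<le> ln B"
    using \<open>h c \<noteq> 0\<close> by (subst ln_le_cancel_iff) (auto simp: B_def)
  then have "ln (cmod (h c) ^ n) \<le> n / (2 * pi) * (integral {-pi..pi} g + e)"
    by (simp add: B_def)
  then have "n * (2 * pi * ln (cmod (h c))) \<le> n * (integral {-pi..pi} g + e)"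
    using \<open>h c \<noteq> 0\<close> by (simp add: ln_realpow field_simps)
  then show "2 * pi * ln (cmod (h c)) \<le> integral {-pi..pi} g + e"
    using n(1) by (simp add: mult_le_cancel_left_pos del: mult.assoc)
qed

text \<open>Reduction to the continuous case: cutting \<open>ln |h|\<close> off at \<open>-N\<close>
  makes it continuous and periodic on the circle even where \<open>h\<close> vanishes, and it stays
  below \<open>max (G t) (-N)\<close>. Dominated convergence then lets \<open>N\<close> tend to
  infinity.\<close>

lemma ln_cmod_le_integral:
  fixes h :: "complex \<Rightarrow> complex"
  assumes "r > 0" and cont: "continuous_on (cball c r) h" and hol: "h holomorphic_on ball c r"
    and "h c \<noteq> 0" and G: "G absolutely_integrable_on {-pi..pi}"
    and bound: "\<And>t. t \<in> {-pi..pi} \<Longrightarrow> cmod (h (c + of_real r * cis t)) \<le> exp (G t)"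
  shows "2 * pi * ln (cmod (h c)) \<le> integral {-pi..pi} G"
proof -
  have int: "(\<lambda>t. max (G t) (- real N)) integrable_on {-pi..pi}" for N
    using absolutely_integrable_max_1[OF G, of "\<lambda>_. - real N"]
    by (auto intro: set_lebesgue_integral_eq_integral)
  have le: "2 * pi * ln (cmod (h c)) \<le> integral {-pi..pi} (\<lambda>t. max (G t) (- real N))" for N
  proof -
    define g where "g t = ln (max (cmod (h (c + of_real r * cis t))) (exp (- real N)))" for t
    have pos: "max x (exp (- real N)) > 0" for x
      by (simp add: less_max_iff_disj)
    have "continuous_on UNIV (\<lambda>t. h (c + of_real r * cis t))"
      using \<open>r > 0\<close> by (intro continuous_on_compose2[OF cont])
        (auto simp: dist_norm norm_mult intro!: continuous_intros)
    then have contg: "continuous_on UNIV g"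
      unfolding g_def by (auto intro!: continuous_intros simp: less_imp_neq[OF pos, symmetric])
    have "2 * pi * ln (cmod (h c)) \<le> integral {-pi..pi} g"
    proof (rule ln_cmod_le_integral_continuous[OF \<open>r > 0\<close> cont hol \<open>h c \<noteq> 0\<close> contg])
      show "cmod (h (c + of_real r * cis t)) \<le> exp (g t)" for t
        using pos by (simp add: g_def)
    qed (simp add: g_def flip: cis_mult)
    also have "\<dots> \<le> integral {-pi..pi} (\<lambda>t. max (G t) (- real N))"
    proof (rule integral_le[OF _ int])
      show "g integrable_on {-pi..pi}"
        using contg by (intro integrable_continuous_interval) (rule continuous_on_subset, auto)
      fix t assume "t \<in> {-pi..pi}"
      then have "max (cmod (h (c + of_real r * cis t))) (exp (- real N)) \<le> max (exp (G t)) (exp (- real N))"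
        using bound[of t] by (intro max.mono) auto
      also have "\<dots> = exp (max (G t) (- real N))" by (simp add: max_def)
      finally have "max (cmod (h (c + of_real r * cis t))) (exp (- real N)) \<le> exp (max (G t) (- real N))" .
      then show "g t \<le> max (G t) (- real N)"
        unfolding g_def using pos ln_le_cancel_iff exp_gt_zero ln_exp by metis
    qed
    finally show ?thesis .
  qed
  have "(\<lambda>N. integral {-pi..pi} (\<lambda>t. max (G t) (- real N))) \<longlonglongrightarrow> integral {-pi..pi} G"
  \<comment> \<open>Since \<open>-N \<le> 0\<close>, truncation never increases the absolute value,
    so \<open>\<bar>G t\<bar>\<close> dominates.\<close>
  proof (rule dominated_convergence(2)[where h = "\<lambda>t. \<bar>G t\<bar>"])
    show "(\<lambda>t. \<bar>G t\<bar>) integrable_on {-pi..pi}"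
      using G by (auto simp: absolutely_integrable_on_def)
    fix t
    obtain M :: nat where "- G t < M" using reals_Archimedean2 by blast
    then have "\<forall>N\<ge>M. max (G t) (- real N) = G t" by (auto simp: max_def)
    then show "(\<lambda>N. max (G t) (- real N)) \<longlonglongrightarrow> G t"
      by (intro tendsto_eventually) (auto simp: eventually_sequentially)
  qed (use int in auto)
  then show ?thesis
    by (rule LIMSEQ_le_const) (use le in auto)
qed

text \<open>The zeros are divided out one at a time, each quotient having a removable singularity.
  Only one factor is taken per zero, so \<open>q\<close> may vanish again on \<open>Z\<close>; for
  an inequality this is enough.\<close>

lemma holomorphic_factor_zeros:
  assumes "g holomorphic_on S" "open S" "finite Z" "\<And>a. a \<in> Z \<Longrightarrow> a \<in> S \<and> g a = 0"
  obtains q where "q holomorphic_on S" "\<And>z. z \<in> S \<Longrightarrow> g z = q z * (\<Prod>a\<in>Z. z - a)"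
  using assms(3,4)
proof (induction Z arbitrary: thesis)
  case empty
  then show ?case using assms(1) by simp
next
  case (insert a Z)
  obtain q where q: "q holomorphic_on S" "\<And>z. z \<in> S \<Longrightarrow> g z = q z * (\<Prod>a\<in>Z. z - a)"
    using insert.IH insert.prems(2) by blast
  have "a \<in> S" "g a = 0" using insert.prems(2) by auto
  \<comment> \<open>The product over \<open>Z\<close> is nonzero at the new point \<open>a\<close>,
    which lies outside \<open>Z\<close>.\<close>
  then have "q a = 0" using q(2)[of a] insert.hyps by auto
  define p where "p z = (if z = a then deriv q a else (q z - q a) / (z - a))" for z
  have "p holomorphic_on S"
    unfolding p_def by (rule pole_lemma_open[OF q(1) assms(2)])
  moreover have "g z = p z * (\<Prod>a\<in>insert a Z. z - a)" if "z \<in> S" for z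
    using q(2)[OF that] \<open>q a = 0\<close> insert.hyps by (simp add: p_def)
  ultimately show ?case using insert.prems(1) by blast
qed

text \<open>Exchanging the linear factors for Blaschke numerators keeps the modulus on the circle
  and multiplies the modulus at the centre by the product of \<open>r / \<bar>a - c\<bar>\<close>.
  The previous mean value bound, applied to the new function, gives the claim. Zeros count without
  multiplicity, and those on the circle contribute \<open>ln 1 = 0\<close>.\<close>

lemma jensen_inequality:
  fixes g :: "complex \<Rightarrow> complex"
  assumes "r > 0" and hol: "g holomorphic_on S" and "open S" and sub: "cball c r \<subseteq> S"
    and "g c \<noteq> 0" and G: "G absolutely_integrable_on {-pi..pi}"
    and bound: "\<And>t. t \<in> {-pi..pi} \<Longrightarrow> cmod (g (c + of_real r * cis t)) \<le> exp (G t)"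
    and "finite Z" and Z: "\<And>a. a \<in> Z \<Longrightarrow> a \<in> cball c r \<and> g a = 0"
  shows "2 * pi * (ln (cmod (g c)) + (\<Sum>a\<in>Z. ln (r / cmod (a - c)))) \<le> integral {-pi..pi} G"
proof -
  obtain q where q: "q holomorphic_on S" "\<And>z. z \<in> S \<Longrightarrow> g z = q z * (\<Prod>a\<in>Z. z - a)"
    using holomorphic_factor_zeros[OF hol \<open>open S\<close> \<open>finite Z\<close>] Z sub by blast
  \<comment> \<open>Each factor \<open>z - a\<close> is replaced by a Blaschke factor of the same modulus on the circle.\<close>
  define h where "h z = q z * (\<Prod>a\<in>Z. (of_real r ^ 2 - cnj (a - c) * (z - c)) / of_real r)" for z
  have holh: "h holomorphic_on S"
    unfolding h_def using q(1) \<open>r > 0\<close> by (auto intro!: holomorphic_intros)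
  have c: "c \<in> S" using sub \<open>r > 0\<close> by auto
  have qc: "q c \<noteq> 0" using q(2)[OF c] \<open>g c \<noteq> 0\<close> by auto
  have ne: "a \<noteq> c" if "a \<in> Z" for a using that Z \<open>g c \<noteq> 0\<close> by auto
  have hc: "h c = q c * (\<Prod>a\<in>Z. of_real r)"
    using \<open>r > 0\<close> by (simp add: h_def power2_eq_square)
  have "2 * pi * ln (cmod (h c)) \<le> integral {-pi..pi} G"
  proof (rule ln_cmod_le_integral[where h = h, OF \<open>r > 0\<close> _ _ _ G])
    show "continuous_on (cball c r) h"
      using holh sub by (meson holomorphic_on_imp_continuous_on holomorphic_on_subset)
    show "h holomorphic_on ball c r"
      using holh sub ball_subset_cball by (meson holomorphic_on_subset)
    show "h c \<noteq> 0" using hc qc \<open>r > 0\<close> by simp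
    fix t :: real assume t: "t \<in> {-pi..pi}"
    define u where "u = of_real r * cis t"
    have "cmod u = r" using \<open>r > 0\<close> by (simp add: u_def norm_mult)
    then have u: "cmod u = r" "u * cnj u = of_real r ^ 2"
      using complex_norm_square[of u] by auto
    have uS: "c + u \<in> S" using sub u by (auto simp: dist_norm)
    have "cmod ((of_real r ^ 2 - cnj (a - c) * u) / of_real r) = cmod (c + u - a)" for a
    proof -
      have "of_real r ^ 2 - cnj (a - c) * u = u * cnj (c + u - a)"
        by (simp add: u(2)[symmetric] algebra_simps)
      then show ?thesis using \<open>r > 0\<close> u(1) by (simp add: norm_divide norm_mult del: complex_cnj_diff complex_cnj_add)
    qed
    then have "cmod (h (c + u)) = cmod (g (c + u))"
      using q(2)[OF uS] by (simp add: h_def norm_mult prod_norm[symmetric])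
    then show "cmod (h (c + of_real r * cis t)) \<le> exp (G t)"
      using bound[OF t] by (simp add: u_def)
  qed
  moreover have "ln (cmod (h c)) = ln (cmod (q c)) + (\<Sum>a\<in>Z. ln r)"
    using qc \<open>r > 0\<close> by (simp add: hc norm_mult norm_power ln_mult ln_realpow)
  moreover have "ln (cmod (g c)) = ln (cmod (q c)) + (\<Sum>a\<in>Z. ln (cmod (c - a)))"
  proof -
    have "(\<Prod>a\<in>Z. cmod (c - a)) > 0" using ne by (intro prod_pos) auto
    moreover have "ln (\<Prod>a\<in>Z. cmod (c - a)) = (\<Sum>a\<in>Z. ln (cmod (c - a)))"
      using ne \<open>finite Z\<close> by (intro ln_prod) auto
    ultimately show ?thesis
      using qc by (simp add: q(2)[OF c] norm_mult prod_norm[symmetric] ln_mult)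
  qed
  moreover have "(\<Sum>a\<in>Z. ln (r / cmod (a - c))) = (\<Sum>a\<in>Z. ln r) - (\<Sum>a\<in>Z. ln (cmod (c - a)))"
    unfolding sum_subtractf[symmetric] using ne \<open>r > 0\<close>
    by (intro sum.cong) (auto simp: ln_div norm_minus_commute)
  ultimately show ?thesis by simp
qed

section \<open>Variation of an angle and zeros of its cosine\<close>

text \<open>A closed interval of length at least \<open>k * pi\<close> contains \<open>k\<close> odd
  multiples of \<open>pi / 2\<close>, and by the intermediate value theorem \<open>a\<close> attains
  each of them.\<close>

lemma cos_zeros_of_variation:
  fixes a :: "real \<Rightarrow> real"
  assumes cont: "continuous_on {s..t} a" and "s \<le> t" and var: "k * pi \<le> \<bar>a s - a t\<bar>"
  obtains X where "finite X" "card X = k" "X \<subseteq> {x \<in> {s..t}. cos (a x) = 0}"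
proof -
  define A where "A = min (a s) (a t)"
  define B where "B = max (a s) (a t)"
  have AB: "A + k * pi \<le> B" using var by (auto simp: A_def B_def min_def max_def)
  have "connected (a ` {s..t})"
    using cont by (intro connected_continuous_image) auto
  moreover have "A \<in> a ` {s..t}" "B \<in> a ` {s..t}"
    using \<open>s \<le> t\<close> by (auto simp: A_def B_def min_def max_def)
  ultimately have img: "{A..B} \<subseteq> a ` {s..t}" by (rule connected_contains_Icc)
  \<comment> \<open>The least integer with \<open>A \<le> pi * j + pi / 2\<close>; minimality puts
    this first zero below \<open>A + pi\<close>.\<close>
  define j where "j = \<lceil>A / pi - 1 / 2\<rceil>"
  \<comment> \<open>The \<open>k\<close> consecutive zeros of the cosine from \<open>A\<close> on.\<close>
  define p where "p i = pi * (of_int j + real i) + pi / 2" for i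
  have "p i \<in> {A..B}" if "i < k" for i
  proof -
    have "A / pi - 1 / 2 \<le> of_int j" "of_int j < A / pi + 1 / 2"
      unfolding j_def by linarith+
    then have "A \<le> pi * of_int j + pi / 2" "pi * of_int j + pi / 2 < A + pi"
      by (simp_all add: field_simps)
    moreover have "pi * (real i + 1) \<le> pi * k" using that by (intro mult_left_mono) auto
    moreover have "0 \<le> pi * real i" by simp
    ultimately show ?thesis using AB unfolding p_def by (simp_all only: atLeastAtMost_iff distrib_left mult.commute[of _ pi]) linarith
  qed
  then have "\<forall>i\<in>{..<k}. \<exists>x\<in>{s..t}. a x = p i" using img by fastforce
  then obtain x where x: "\<And>i. i < k \<Longrightarrow> x i \<in> {s..t} \<and> a (x i) = p i"
    by (metis lessThan_iff)
  have "inj_on x {..<k}"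
  proof (rule inj_onI)
    fix i j assume "i \<in> {..<k}" "j \<in> {..<k}" "x i = x j"
    then have "p i = p j" using x by (metis lessThan_iff)
    then show "i = j" by (simp add: p_def)
  qed
  then have "card (x ` {..<k}) = k" by (simp add: card_image)
  moreover have "cos (p i) = 0" for i
  proof -
    have "p i = of_int (2 * (j + int i) + 1) * (pi / 2)"
      by (simp add: p_def algebra_simps)
    then show ?thesis unfolding cos_zero_iff_int by (metis even_plus_one_iff dvd_triv_left)
  qed
  ultimately show ?thesis using x by (intro that[of "x ` {..<k}"]) auto
qed

text \<open>A larger variation would force one more zero than there are.\<close>

lemma variation_le_card_cos_zeros:
  fixes a :: "real \<Rightarrow> real"
  assumes "continuous_on {s..t} a" and "s \<le> t" and fin: "finite {x \<in> {s..t}. cos (a x) = 0}"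
  shows "\<bar>a s - a t\<bar> \<le> pi * (real (card {x \<in> {s..t}. cos (a x) = 0}) + 1)"
proof (rule ccontr)
  define n where "n = card {x \<in> {s..t}. cos (a x) = 0}"
  assume "\<not> ?thesis"
  then have "real (n + 1) * pi \<le> \<bar>a s - a t\<bar>" by (simp add: n_def mult.commute add.commute)
  from cos_zeros_of_variation[OF assms(1,2) this] obtain X where
    "finite X" "card X = n + 1" "X \<subseteq> {x \<in> {s..t}. cos (a x) = 0}" .
  with card_mono[OF fin this(3)] show False by (simp add: n_def)
qed

text \<open>The count of zeros in \<open>{x..t}\<close> is a sum of indicators of
  \<open>x \<le> z\<close>. Integrated over \<open>x\<close>, the zero \<open>z\<close> yields
  \<open>z - s\<close>, and the extra 1 yields \<open>t - s\<close>.\<close>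

lemma integral_variation_le_cos_zeros:
  fixes a :: "real \<Rightarrow> real"
  assumes cont: "continuous_on {s..t} a" and "s \<le> t" and fin: "finite {x \<in> {s..t}. cos (a x) = 0}"
  shows "integral {s..t} (\<lambda>x. \<bar>a x - a t\<bar>)
           \<le> pi * ((\<Sum>z\<in>{x \<in> {s..t}. cos (a x) = 0}. z - s) + (t - s))"
proof -
  define Z where "Z = {x \<in> {s..t}. cos (a x) = 0}"
  have "((\<lambda>x. if x \<in> {s..z} then 1 else 0) has_integral (z - s)) {s..t}" if "z \<in> Z" for z
    using that has_integral_const_real[of "1::real" s z]
    by (subst has_integral_restrict) (auto simp: Z_def)
  then have "((\<lambda>x. \<Sum>z\<in>Z. if x \<in> {s..z} then 1 else 0) has_integral (\<Sum>z\<in>Z. z - s)) {s..t}"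
    using fin by (intro has_integral_sum) (auto simp: Z_def)
  moreover have "((\<lambda>x. 1) has_integral (t - s)) {s..t}"
    using has_integral_const_real[of "1::real" s t] \<open>s \<le> t\<close> by simp
  ultimately have "((\<lambda>x. pi * ((\<Sum>z\<in>Z. if x \<in> {s..z} then 1 else 0) + 1)) has_integral
      pi * ((\<Sum>z\<in>Z. z - s) + (t - s))) {s..t}"
    by (intro has_integral_mult_right has_integral_add)
  moreover have "((\<lambda>x. \<bar>a x - a t\<bar>) has_integral integral {s..t} (\<lambda>x. \<bar>a x - a t\<bar>)) {s..t}"
    using cont by (intro integrable_integral integrable_continuous_interval continuous_intros)
  moreover have "\<bar>a x - a t\<bar> \<le> pi * ((\<Sum>z\<in>Z. if x \<in> {s..z} then 1 else 0) + 1)" if x: "x \<in> {s..t}" for x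
  proof -
    have eq: "{y \<in> {x..t}. cos (a y) = 0} = {z \<in> Z. x \<in> {s..z}}" using x by (auto simp: Z_def)
    have "\<bar>a x - a t\<bar> \<le> pi * (real (card {z \<in> Z. x \<in> {s..z}}) + 1)"
      unfolding eq[symmetric]
    proof (rule variation_le_card_cos_zeros)
      show "continuous_on {x..t} a" using cont by (rule continuous_on_subset) (use x in auto)
      show "finite {y \<in> {x..t}. cos (a y) = 0}" unfolding eq using fin by (auto simp: Z_def intro: rev_finite_subset)
    qed (use x in auto)
    also have "real (card {z \<in> Z. x \<in> {s..z}}) = (\<Sum>z\<in>Z. if x \<in> {s..z} then 1 else 0)"
      using fin by (simp add: sum.If_cases Z_def Int_def)
    finally show ?thesis by simp
  qed
  ultimately show ?thesis
    unfolding Z_def[symmetric] by (meson has_integral_le)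
qed

section \<open>The Jensen weight and the choice of the exponent\<close>

text \<open>Put \<open>u = \<bar>x - c\<bar> / r\<close>. Left of \<open>c\<close> the claim is
  \<open>ln u \<le> u - 1\<close>. Right of \<open>c\<close> it is
  \<open>1 + u + ln u \<le> 0\<close>, whose left side increases in \<open>u\<close> and vanishes at
  \<open>\<eta>\<close>; the condition on \<open>\<sigma>\<^sub>1\<close> says that
  \<open>u \<le> \<eta>\<close>.\<close>

lemma distance_le_jensen_weight:
  fixes \<sigma>\<^sub>0 \<sigma>\<^sub>1 \<eta> c x :: real
  assumes "0 < \<eta>" "\<eta> < 1" "1 + \<eta> + ln \<eta> = 0" "\<sigma>\<^sub>0 < c" "\<sigma>\<^sub>1 - c \<le> \<eta> * (c - \<sigma>\<^sub>0)"
    and x: "\<sigma>\<^sub>0 \<le> x" "x \<le> \<sigma>\<^sub>1" "x \<noteq> c"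
  shows "x - \<sigma>\<^sub>0 \<le> (c - \<sigma>\<^sub>0) * ln ((c - \<sigma>\<^sub>0) / \<bar>x - c\<bar>)"
proof -
  define r where "r = c - \<sigma>\<^sub>0"
  define u where "u = \<bar>x - c\<bar> / r"
  have r: "r > 0" using assms by (simp add: r_def)
  have u: "u > 0" using r x by (simp add: u_def)
  have "(x - \<sigma>\<^sub>0) / r + ln u \<le> 0"
  proof (cases "x < c")
    case True
    then have "(x - \<sigma>\<^sub>0) / r = 1 - u" using r by (simp add: u_def r_def field_simps)
    then show ?thesis using ln_le_minus_one[OF u] by simp
  next
    case False
    then have *: "(x - \<sigma>\<^sub>0) / r = 1 + u" using r by (simp add: u_def r_def field_simps)
    have "x - c \<le> \<eta> * r" using assms unfolding r_def by linarith
    then have "u \<le> \<eta>" using False r by (simp add: u_def pos_divide_le_eq)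
    then have "ln u \<le> ln \<eta>" using u by simp
    then show ?thesis using * \<open>u \<le> \<eta>\<close> assms by linarith
  qed
  moreover have "ln (r / \<bar>x - c\<bar>) = - ln u" using r x by (simp add: u_def ln_div)
  ultimately have "(x - \<sigma>\<^sub>0) / r \<le> ln (r / \<bar>x - c\<bar>)" by simp
  then show ?thesis unfolding r_def[symmetric] using r by (simp add: pos_divide_le_eq mult.commute)
qed

lemma log_abs_le_ereal_iff: "log_abs z \<le> ereal x \<longleftrightarrow> cmod z \<le> exp x"
proof (cases "z = 0")
  case False
  then show ?thesis
    by (simp add: log_abs_def) (metis exp_le_cancel_iff exp_ln zero_less_norm_iff)
qed (simp add: log_abs_def)

text \<open>Either \<open>m\<close> or \<open>2 * m\<close> works: if
  \<open>\<bar>cos (m * \<alpha>)\<bar> < 1 / 2\<close>, the double angle formula gives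
  \<open>cos (2 * m * \<alpha>) < - 1 / 2\<close>. This keeps the auxiliary function away from zero
  at the centre for arbitrarily large exponents.\<close>

lemma exists_multiple_cos_ge_half:
  fixes m :: nat and \<alpha> :: real
  assumes "m > 0"
  obtains k where "k \<ge> m" "\<bar>cos (k * \<alpha>)\<bar> \<ge> 1 / 2"
proof (cases "\<bar>cos (m * \<alpha>)\<bar> \<ge> 1 / 2")
  case False
  then have "\<bar>cos (m * \<alpha>)\<bar>\<^sup>2 < (1 / 2)\<^sup>2" by (intro power_strict_mono) auto
  moreover have "cos ((2 * m) * \<alpha>) = 2 * (cos (m * \<alpha>))\<^sup>2 - 1"
    using cos_double_cos[of "m * \<alpha>"] by (simp add: mult.assoc)
  ultimately have "\<bar>cos ((2 * m) * \<alpha>)\<bar> \<ge> 1 / 2" by (simp add: power2_eq_square)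
  then show ?thesis using that[of "2 * m"] by simp
qed (use that in auto)

section \<open>The estimate for a fixed exponent\<close>

text \<open>Zero counting and Jensen's inequality bound the variation of \<open>m * a\<close>;
  dividing by \<open>m\<close> leaves a main term free of \<open>m\<close>. In the error,
  \<open>r * ln 2\<close> comes from the cosine at the centre and
  \<open>\<sigma>\<^sub>1 - \<sigma>\<^sub>0\<close> from the extra 1 in the zero count.\<close>

lemma integral_arg_variation_le:
  fixes \<sigma>\<^sub>0 \<sigma>\<^sub>1 T \<eta> c r :: real
    and f :: "complex \<Rightarrow> complex" and F a :: "real \<Rightarrow> real" and m :: nat
  assumes \<eta>: "0 < \<eta>" "\<eta> < 1" "1 + \<eta> + ln \<eta> = 0"
    and c: "\<sigma>\<^sub>0 < c" "c \<le> \<sigma>\<^sub>1" "\<sigma>\<^sub>1 - c \<le> \<eta> * (c - \<sigma>\<^sub>0)" and r: "r = c - \<sigma>\<^sub>0"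
    and anal: "f analytic_on (cball (Complex c T) r \<union> cball (Complex c (- T)) r)"
    and cnj: "\<And>s. s \<in> cball (Complex c T) r \<Longrightarrow> cnj (f s) = f (cnj s)"
    and nz: "f (Complex c T) \<noteq> 0"
    and F: "F absolutely_integrable_on {-pi..pi}"
    and bound: "\<And>t. t \<in> {-pi..pi} \<Longrightarrow> cmod (f (Complex c T + of_real r * cis t)) \<le> exp (F t)"
      "\<And>t. t \<in> {-pi..pi} \<Longrightarrow> cmod (f (Complex c (- T) + of_real r * cis t)) \<le> exp (F t)"
    and cont: "continuous_on {\<sigma>\<^sub>0..\<sigma>\<^sub>1} a"
    and arg: "\<And>x. x \<in> {\<sigma>\<^sub>0..\<sigma>\<^sub>1} \<Longrightarrow> f (Complex x T) = of_real (cmod (f (Complex x T))) * cis (a x)"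
    and m: "m > 0" "\<bar>cos (m * a c)\<bar> \<ge> 1 / 2"
  shows "integral {\<sigma>\<^sub>0..\<sigma>\<^sub>1} (\<lambda>x. \<bar>a x - a \<sigma>\<^sub>1\<bar>)
    \<le> r * (integral {-pi..pi} F / 2 - pi * ln (cmod (f (Complex c T))))
        + pi * (r * ln 2 + (\<sigma>\<^sub>1 - \<sigma>\<^sub>0)) / m"
proof -
  \<comment> \<open>On the real line \<open>g\<close> is \<open>Re (f (x + \<i>T) ^ m)\<close>, which vanishes exactly where \<open>cos (m * a x)\<close> does.\<close>
  define g where "g z = (f (z + \<i> * of_real T) ^ m + f (z - \<i> * of_real T) ^ m) / 2" for z
  have rpos: "r > 0" using c r by simp
  have shift: "of_real x + \<i> * of_real T = Complex x T" "of_real x - \<i> * of_real T = Complex x (- T)" for x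
    by (simp_all add: complex_eq_iff)
  \<comment> \<open>On the left \<open>\<sigma>\<^sub>0\<close> is at distance exactly
    \<open>r\<close>; on the right \<open>\<eta> < 1\<close> keeps \<open>\<sigma>\<^sub>1\<close>
    within \<open>r\<close>.\<close>
  have disc: "\<bar>x - c\<bar> \<le> r" if "x \<in> {\<sigma>\<^sub>0..\<sigma>\<^sub>1}" for x
  proof -
    have "\<eta> * r \<le> r" using \<eta> rpos by simp
    moreover have "\<sigma>\<^sub>1 - c \<le> \<eta> * r" "\<sigma>\<^sub>0 \<le> x" "x \<le> \<sigma>\<^sub>1" using c(3) r that by auto
    ultimately show ?thesis using r by linarith
  qed
  have g_real: "g (of_real x) = of_real (cmod (f (Complex x T)) ^ m * cos (m * a x))"
    if x: "x \<in> {\<sigma>\<^sub>0..\<sigma>\<^sub>1}" for x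
  proof -
    have "cnj (f (Complex x T)) = f (cnj (Complex x T))"
      using disc[OF x] by (intro cnj) (simp add: dist_norm complex_norm complex_diff abs_minus_commute)
    moreover have "cnj (Complex x T) = Complex x (- T)" by (simp add: complex_eq_iff)
    ultimately have "g (of_real x) = (f (Complex x T) ^ m + cnj (f (Complex x T) ^ m)) / 2"
      by (simp add: g_def shift)
    also have "\<dots> = of_real (Re (f (Complex x T) ^ m))"
      unfolding complex_add_cnj by simp
    also have "f (Complex x T) ^ m = of_real (cmod (f (Complex x T)) ^ m) * cis (m * a x)"
      by (subst arg[OF x]) (simp add: power_mult_distrib Complex.DeMoivre)
    finally show ?thesis by simp
  qed
  obtain U where U: "open U" "cball (Complex c T) r \<union> cball (Complex c (- T)) r \<subseteq> U" "f holomorphic_on U"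
    using anal unfolding analytic_on_holomorphic by blast
  \<comment> \<open>The points whose two vertical translates both lie in the domain of
    \<open>f\<close>.\<close>
  define V where "V = (\<lambda>z. z + \<i> * of_real T) -` U \<inter> (\<lambda>z. z - \<i> * of_real T) -` U"
  have "open V"
    unfolding V_def using U(1) by (intro open_Int open_vimage) (auto intro!: continuous_intros)
  have dist_shift: "dist (Complex c T) (z + \<i> * of_real T) = dist (of_real c) z"
    "dist (Complex c (- T)) (z - \<i> * of_real T) = dist (of_real c) z" for z
    by (simp_all add: dist_norm flip: shift)
  have "cball (of_real c) r \<subseteq> V"
  proof
    fix z :: complex assume "z \<in> cball (of_real c) r"
    then have "z + \<i> * of_real T \<in> U" "z - \<i> * of_real T \<in> U"
      using U(2) dist_shift[of z] by auto
    then show "z \<in> V" by (simp add: V_def)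
  qed
  \<comment> \<open>Finiteness of the zero set needs a connected domain.\<close>
  define S where "S = connected_component_set V (of_real c)"
  have S: "open S" "connected S" "S \<subseteq> V"
    unfolding S_def using \<open>open V\<close> by (auto simp: open_connected_component connected_component_subset)
  have S_cball: "cball (of_real c) r \<subseteq> S"
    unfolding S_def using \<open>cball (of_real c) r \<subseteq> V\<close> rpos
    by (intro connected_component_maximal) auto
  have "(\<lambda>z. f (z + \<i> * of_real T)) holomorphic_on S" "(\<lambda>z. f (z - \<i> * of_real T)) holomorphic_on S"
    using S(3) by (intro holomorphic_on_compose_gen[OF _ U(3), unfolded o_def];
        auto simp: V_def intro!: holomorphic_intros)+
  then have holg: "g holomorphic_on S"
    unfolding g_def by (auto intro!: holomorphic_intros)
  \<comment> \<open>The lower bound on the cosine costs at most a factor 2 here, the source of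
    \<open>ln 2\<close>.\<close>
  have gc: "cmod (g (of_real c)) \<ge> cmod (f (Complex c T)) ^ m / 2"
  proof -
    have "c \<in> {\<sigma>\<^sub>0..\<sigma>\<^sub>1}" using c by simp
    then have "cmod (g (of_real c)) = cmod (f (Complex c T)) ^ m * \<bar>cos (m * a c)\<bar>"
      by (simp add: g_real abs_mult del: of_real_mult)
    also have "\<dots> \<ge> cmod (f (Complex c T)) ^ m * (1 / 2)"
      using m(2) by (intro mult_left_mono) auto
    finally show ?thesis by simp
  qed
  moreover have fpos: "cmod (f (Complex c T)) ^ m > 0" using nz by simp
  ultimately have gc_nz: "g (of_real c) \<noteq> 0" by auto
  define Z where "Z = {x \<in> {\<sigma>\<^sub>0..\<sigma>\<^sub>1}. cos (m * a x) = 0}"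
  have Z_zero: "complex_of_real x \<in> cball (of_real c) r \<and> g (of_real x) = 0" if "x \<in> Z" for x
    using that disc[of x] g_real[of x]
    by (auto simp: Z_def dist_real_def abs_minus_commute)
  have "finite {z \<in> cball (of_real c) r. g z = 0}"
  \<comment> \<open>A constant \<open>g\<close> is nonzero throughout, having its value at the
    centre; otherwise zeros are isolated and the disc is compact.\<close>
  proof (cases "g constant_on S")
    case True
    have "of_real c \<in> S" using S_cball rpos by auto
    then have "g z \<noteq> 0" if "z \<in> cball (of_real c) r" for z
      using that True gc_nz S_cball unfolding constant_on_def by (metis subsetD)
    then have "{z \<in> cball (of_real c) r. g z = 0} = {}" by auto
    then show ?thesis by (simp only: finite.emptyI)
  next
    case False
    then show ?thesis
      by (intro holomorphic_compact_finite_zeros[OF holg S(1,2) _ S_cball]) auto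
  qed
  then have "finite (of_real ` Z :: complex set)"
    by (rule rev_finite_subset) (use Z_zero in auto)
  then have "finite Z" by (rule finite_imageD) (auto intro: inj_onI)
  have "2 * pi * (ln (cmod (g (of_real c))) + (\<Sum>z\<in>of_real ` Z. ln (r / cmod (z - of_real c))))
      \<le> integral {-pi..pi} (\<lambda>t. m * F t)"
  proof (rule jensen_inequality[OF rpos holg S(1) S_cball gc_nz])
    show "(\<lambda>t. m * F t) absolutely_integrable_on {-pi..pi}"
      using F by (rule set_integrable_mult_right)
    fix t :: real assume t: "t \<in> {-pi..pi}"
    define w where "w = of_real c + of_real r * cis t"
    have w: "w + \<i> * of_real T = Complex c T + of_real r * cis t"
      "w - \<i> * of_real T = Complex c (- T) + of_real r * cis t"
      by (simp_all add: w_def flip: shift)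
    have "cmod (g w) \<le> (cmod (f (w + \<i> * of_real T)) ^ m + cmod (f (w - \<i> * of_real T)) ^ m) / 2"
      using norm_triangle_ineq[of "f (w + \<i> * of_real T) ^ m" "f (w - \<i> * of_real T) ^ m"]
      by (simp add: g_def norm_divide norm_power)
    also have "\<dots> \<le> (exp (F t) ^ m + exp (F t) ^ m) / 2"
      unfolding w using bound[OF t] by (intro divide_right_mono add_mono power_mono) auto
    also have "\<dots> = exp (m * F t)" by (simp add: exp_of_nat_mult)
    finally show "cmod (g (of_real c + of_real r * cis t)) \<le> exp (m * F t)" by (simp add: w_def)
  qed (use \<open>finite Z\<close> Z_zero in auto)
  also have "(\<Sum>z\<in>of_real ` Z. ln (r / cmod (z - of_real c))) = (\<Sum>x\<in>Z. ln (r / \<bar>x - c\<bar>))"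
    by (subst sum.reindex) (auto intro: inj_onI simp flip: of_real_diff)
  finally have jensen: "2 * pi * (ln (cmod (g (of_real c))) + (\<Sum>x\<in>Z. ln (r / \<bar>x - c\<bar>)))
      \<le> m * integral {-pi..pi} F" by simp
  have "ln (cmod (f (Complex c T)) ^ m / 2) \<le> ln (cmod (g (of_real c)))"
    using gc fpos by (subst ln_le_cancel_iff) auto
  then have ln_gc: "m * ln (cmod (f (Complex c T))) - ln 2 \<le> ln (cmod (g (of_real c)))"
    using nz by (simp add: ln_div ln_realpow)
  have "(\<Sum>x\<in>Z. x - \<sigma>\<^sub>0) \<le> (\<Sum>x\<in>Z. r * ln (r / \<bar>x - c\<bar>))"
  proof (rule sum_mono)
    fix x assume x: "x \<in> Z"
    then have "x \<noteq> c" using Z_zero[of x] gc_nz by auto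
    then show "x - \<sigma>\<^sub>0 \<le> r * ln (r / \<bar>x - c\<bar>)"
      using x distance_le_jensen_weight[OF \<eta> c(1,3)] by (auto simp: Z_def r)
  qed
  also have "\<dots> \<le> r * (m * integral {-pi..pi} F / (2 * pi) - m * ln (cmod (f (Complex c T))) + ln 2)"
  proof -
    have "ln (cmod (g (of_real c))) + (\<Sum>x\<in>Z. ln (r / \<bar>x - c\<bar>)) \<le> m * integral {-pi..pi} F / (2 * pi)"
      using jensen by (subst pos_le_divide_eq) (auto simp: mult.commute)
    then show ?thesis
      unfolding sum_distrib_left[symmetric] using ln_gc rpos by (intro mult_left_mono) auto
  qed
  finally have sumZ: "(\<Sum>x\<in>Z. x - \<sigma>\<^sub>0)
      \<le> r * (m * integral {-pi..pi} F / (2 * pi) - m * ln (cmod (f (Complex c T))) + ln 2)" .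
  have "m * integral {\<sigma>\<^sub>0..\<sigma>\<^sub>1} (\<lambda>x. \<bar>a x - a \<sigma>\<^sub>1\<bar>) = integral {\<sigma>\<^sub>0..\<sigma>\<^sub>1} (\<lambda>x. \<bar>m * a x - m * a \<sigma>\<^sub>1\<bar>)"
    by (simp add: abs_mult flip: right_diff_distrib)
  also have "\<dots> \<le> pi * ((\<Sum>x\<in>Z. x - \<sigma>\<^sub>0) + (\<sigma>\<^sub>1 - \<sigma>\<^sub>0))"
    unfolding Z_def using \<open>finite Z\<close> cont c
    by (intro integral_variation_le_cos_zeros) (auto simp: Z_def intro!: continuous_intros)
  also have "\<dots> \<le> pi * (r * (m * integral {-pi..pi} F / (2 * pi) - m * ln (cmod (f (Complex c T))) + ln 2)
      + (\<sigma>\<^sub>1 - \<sigma>\<^sub>0))"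
    using sumZ by simp
  also have "\<dots> = m * (r * (integral {-pi..pi} F / 2 - pi * ln (cmod (f (Complex c T))))
        + pi * (r * ln 2 + (\<sigma>\<^sub>1 - \<sigma>\<^sub>0)) / m)"
    using m(1) by (simp add: field_simps)
  finally show ?thesis using m(1) by simp
qed

section \<open>The limit of large exponents and the stated integrals\<close>

theorem theorem31:
  fixes \<sigma>\<^sub>0 \<sigma>\<^sub>1 T \<eta> c r :: real
    and f :: "complex \<Rightarrow> complex"
    and F :: "real \<Rightarrow> real"
    and arg_f :: "complex \<Rightarrow> real"
  assumes "\<sigma>\<^sub>0 < \<sigma>\<^sub>1" and "T > 0"
    and "\<eta> \<in> {0<..<1}" and "1 + \<eta> + ln \<eta> = 0"
    and "c \<in> {\<sigma>\<^sub>0..\<sigma>\<^sub>1}" and "\<sigma>\<^sub>1 - c \<le> \<eta> * (c - \<sigma>\<^sub>0)"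
    and "r = c - \<sigma>\<^sub>0"
    and "f analytic_on (cball (Complex c T) r \<union> cball (Complex c (- T)) r)"
    and "\<And>s. s \<in> cball (Complex c T) r \<union> cball (Complex c (- T)) r \<Longrightarrow> cnj (f s) = f (cnj s)"
    and "\<And>s. s \<in> closed_segment (Complex \<sigma>\<^sub>0 T) (Complex \<sigma>\<^sub>1 T) \<Longrightarrow> f s \<noteq> 0"
    and "\<And>\<theta>. \<theta> \<in> {-pi..pi} \<Longrightarrow> F (- \<theta>) = F \<theta>"
    and "set_integrable lebesgue {-pi..pi} F"
    and "\<And>\<theta>. \<theta> \<in> {-pi..pi} \<Longrightarrow>
           max (log_abs (f (complex_of_real c + complex_of_real r * exp (\<i> * complex_of_real \<theta>) + \<i> * complex_of_real T)))
               (log_abs (f (complex_of_real c + complex_of_real r * exp (\<i> * complex_of_real \<theta>) - \<i> * complex_of_real T)))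
             \<le> ereal (F \<theta>)"
    and "continuous_argument_on f (closed_segment (Complex \<sigma>\<^sub>0 T) (Complex \<sigma>\<^sub>1 T)) arg_f"
  shows "1 / (2 * pi) * \<bar>(LBINT \<sigma>=\<sigma>\<^sub>1..\<sigma>\<^sub>0. arg_f (Complex \<sigma> T)) - (\<sigma>\<^sub>0 - \<sigma>\<^sub>1) * arg_f (Complex \<sigma>\<^sub>1 T)\<bar>
           \<le> (c - \<sigma>\<^sub>0) / 2 * (- ln (cmod (f (Complex c T))) + 1 / pi * (LINT \<theta>=0..pi|lebesgue. F \<theta>))"
proof -
  define a where "a x = arg_f (Complex x T)" for x
  define I where "I = integral {\<sigma>\<^sub>0..\<sigma>\<^sub>1} (\<lambda>x. \<bar>a x - a \<sigma>\<^sub>1\<bar>)"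
  define J where "J = integral {-pi..pi} F"
  define L where "L = ln (cmod (f (Complex c T)))"
  \<comment> \<open>If \<open>c = \<sigma>\<^sub>0\<close>, the condition on
    \<open>\<sigma>\<^sub>1 - c\<close> would give
    \<open>\<sigma>\<^sub>1 \<le> \<sigma>\<^sub>0\<close>.\<close>
  have c: "\<sigma>\<^sub>0 < c" "c \<le> \<sigma>\<^sub>1"
    using assms(1,5,6) by (auto simp: le_less)
  have rpos: "r > 0" using c assms(7) by simp
  have seg: "Complex x T \<in> closed_segment (Complex \<sigma>\<^sub>0 T) (Complex \<sigma>\<^sub>1 T)" if "x \<in> {\<sigma>\<^sub>0..\<sigma>\<^sub>1}" for x
    using that closed_segment_same_Im[of "Complex \<sigma>\<^sub>0 T" "Complex \<sigma>\<^sub>1 T"] assms(1)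
    by (simp add: closed_segment_eq_real_ivl)
  have cont: "continuous_on {\<sigma>\<^sub>0..\<sigma>\<^sub>1} a"
    unfolding a_def
    by (rule continuous_on_compose2[OF conjunct1[OF assms(14)[unfolded continuous_argument_on_def]]])
      (use seg in \<open>auto simp: Complex_eq intro!: continuous_intros\<close>)
  have arg: "f (Complex x T) = of_real (cmod (f (Complex x T))) * cis (a x)" if "x \<in> {\<sigma>\<^sub>0..\<sigma>\<^sub>1}" for x
    using assms(14) seg[OF that] unfolding continuous_argument_on_def a_def by blast
  have fnz: "f (Complex x T) \<noteq> 0" if "x \<in> {\<sigma>\<^sub>0..\<sigma>\<^sub>1}" for x
    using assms(10) seg[OF that] .
  have nz: "f (Complex c T) \<noteq> 0" using fnz c by simp
  have shift: "of_real c + of_real r * exp (\<i> * of_real t) + \<i> * of_real T = Complex c T + of_real r * cis t"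
    "of_real c + of_real r * exp (\<i> * of_real t) - \<i> * of_real T = Complex c (- T) + of_real r * cis t" for t
    by (simp_all add: Complex_eq cis_conv_exp)
  have bound: "cmod (f (Complex c T + of_real r * cis t)) \<le> exp (F t)"
    "cmod (f (Complex c (- T) + of_real r * cis t)) \<le> exp (F t)" if "t \<in> {-pi..pi}" for t
    using assms(13)[OF that] by (simp_all add: shift log_abs_le_ereal_iff)
  define K where "K = pi * (r * ln 2 + (\<sigma>\<^sub>1 - \<sigma>\<^sub>0))"
  have K: "K \<ge> 0" using rpos assms(1) by (simp add: K_def)
  \<comment> \<open>A suitable exponent \<open>m\<close> is only known to exist beyond
    \<open>n\<close>; since \<open>K \<ge> 0\<close>, replacing \<open>K / m\<close> by
    \<open>K / Suc n\<close> gives a bound for every \<open>n\<close>.\<close>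
  have "I \<le> r * (J / 2 - pi * L) + K / Suc n" for n
  proof -
    obtain m where m: "m \<ge> Suc n" "\<bar>cos (m * a c)\<bar> \<ge> 1 / 2"
      using exists_multiple_cos_ge_half[of "Suc n" "a c"] by auto
    have "I \<le> r * (J / 2 - pi * L) + K / m"
      unfolding I_def J_def L_def K_def
      using integral_arg_variation_le[of \<eta> \<sigma>\<^sub>0 c \<sigma>\<^sub>1 r f T F a m] assms c bound cont arg nz m by auto
    also have "K / m \<le> K / Suc n" using K m(1) by (intro divide_left_mono) auto
    finally show ?thesis by simp
  qed
  moreover have "(\<lambda>n. r * (J / 2 - pi * L) + K / Suc n) \<longlonglongrightarrow> r * (J / 2 - pi * L) + 0"
    by (intro tendsto_intros LIMSEQ_Suc lim_const_over_n)
  ultimately have I_le: "I \<le> r * (J / 2 - pi * L)"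
    by (intro LIMSEQ_le_const[where a = I]) auto
  \<comment> \<open>The reversed endpoints give a minus sign, which the absolute value later
    absorbs.\<close>
  have "(LBINT \<sigma>=\<sigma>\<^sub>1..\<sigma>\<^sub>0. arg_f (Complex \<sigma> T)) = - integral {\<sigma>\<^sub>0..\<sigma>\<^sub>1} a"
    using assms(1) interval_integral_eq_integral[OF _ borel_integrable_atLeastAtMost'[OF cont]]
    by (subst interval_integral_endpoints_reverse) (simp add: a_def)
  moreover have "a integrable_on {\<sigma>\<^sub>0..\<sigma>\<^sub>1}" using cont by (rule integrable_continuous_interval)
  then have "integral {\<sigma>\<^sub>0..\<sigma>\<^sub>1} (\<lambda>x. a x - a \<sigma>\<^sub>1) = integral {\<sigma>\<^sub>0..\<sigma>\<^sub>1} a - (\<sigma>\<^sub>1 - \<sigma>\<^sub>0) * a \<sigma>\<^sub>1"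
    using assms(1) by (subst integral_diff) auto
  ultimately have "(LBINT \<sigma>=\<sigma>\<^sub>1..\<sigma>\<^sub>0. arg_f (Complex \<sigma> T)) - (\<sigma>\<^sub>0 - \<sigma>\<^sub>1) * arg_f (Complex \<sigma>\<^sub>1 T)
      = - integral {\<sigma>\<^sub>0..\<sigma>\<^sub>1} (\<lambda>x. a x - a \<sigma>\<^sub>1)"
    by (simp add: a_def algebra_simps)
  moreover have "\<bar>integral {\<sigma>\<^sub>0..\<sigma>\<^sub>1} (\<lambda>x. a x - a \<sigma>\<^sub>1)\<bar> \<le> I"
    unfolding I_def real_norm_def[symmetric] using cont
    by (intro Henstock_Kurzweil_Integration.integral_norm_bound_integral integrable_continuous_interval)
      (auto intro!: continuous_intros)
  \<comment> \<open>Evenness folds \<open>{-pi..0}\<close> onto \<open>{0..pi}\<close>. The interval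
    integral unfolds to the open interval, and its endpoints do not affect the value.\<close>
  moreover have "J = 2 * (LINT \<theta>=0..pi|lebesgue. F \<theta>)"
  proof -
    have F: "F absolutely_integrable_on {0..pi}"
      using assms(12) by (rule set_integrable_subset) auto
    have "(LINT \<theta>=0..pi|lebesgue. F \<theta>) = (LINT \<theta>:{0<..<pi}|lebesgue. F \<theta>)"
      by (simp add: interval_lebesgue_integral_le_eq zero_ereal_def)
    also have "\<dots> = integral {0<..<pi} F"
      by (intro set_lebesgue_integral_eq_integral set_integrable_subset[OF F]) auto
    also have "\<dots> = integral {0..pi} F"
      using integral_open_interval_real[of 0 pi F] by simp
    finally have "(LINT \<theta>=0..pi|lebesgue. F \<theta>) = integral {0..pi} F" .
    moreover have "J = integral {-pi..0} F + integral {0..pi} F"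
      unfolding J_def using set_lebesgue_integral_eq_integral(1)[OF assms(12)]
      by (intro Henstock_Kurzweil_Integration.integral_combine[symmetric]) auto
    moreover have "integral {-pi..0} F = integral {-pi..0} (\<lambda>x. F (- x))"
      using assms(11) by (intro Henstock_Kurzweil_Integration.integral_cong) auto
    moreover have "\<dots> = integral {0..pi} F"
      using Henstock_Kurzweil_Integration.integral_reflect_real[of pi 0 F] by simp
    ultimately show ?thesis by simp
  qed
  ultimately have "1 / (2 * pi) * \<bar>(LBINT \<sigma>=\<sigma>\<^sub>1..\<sigma>\<^sub>0. arg_f (Complex \<sigma> T)) - (\<sigma>\<^sub>0 - \<sigma>\<^sub>1) * arg_f (Complex \<sigma>\<^sub>1 T)\<bar>
      \<le> 1 / (2 * pi) * (r * ((LINT \<theta>=0..pi|lebesgue. F \<theta>) - pi * L))"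
    using I_le by (intro mult_left_mono) auto
  then show ?thesis
    using assms(7) by (simp add: L_def field_simps)
qed

end
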